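(* Let $A$ be a finite-dimensional real associative algebra with unit, endowed with a positive definite inner product with $\langle1,1\rangle=1$. Suppose that $$\mathcal Z=\{w\in\mathbb C\otimes A:\ \Phi(ww')=0\ \text{for every } w'\in\mathbb C\otimes A\}$$ is irreducible as a complex subvariety of $\mathbb C\otimes A$. Then $\mathcal Z$ coincides with $$Z_0=\{w\in\mathbb C\otimes A:\ \pi(w,s)=0\text{ for some }s\in S_0\}.$$
   Context: $L_a(x)=ax$ on $A$, with adjoint $L_a^t$ for the inner product (no compatibility with the algebra structure is assumed). $S_0=\{s\in A: s^2=-1,\ L_sL_s^t=I\}$. The tensor product $\mathbb C\otimes A$ is over $\mathbb R$ and is a complex algebra. $\pi(1\otimes a+i\otimes b,s)=a+sb$. $Q$ is the $\mathbb C$-bilinear extension of the inner product to $\mathbb C\otimes A$ and $\Phi(w)=Q(w,w)$.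
   Formalization: The formal theorem additionally assumes that S_0 is nonempty; without it the claim fails (A = R gives 𝒵 = {0}, irreducible, but Z_0 empty), and since 0 is always in 𝒵 the equality 𝒵 = Z_0 itself forces S_0 to be nonempty. *)

theory Defs
  imports "HOL-Analysis.Analysis"
begin

text \<open>
  A finite-dimensional real associative unital algebra with a positive definite inner product is
  a type of sort \<open>{real_algebra_1, euclidean_space}\<close>. These classes impose no compatibility
  between the product and the inner product.
\<close>


section \<open>The complex algebra \<open>\<complex> \<otimes> A\<close>\<close>

text \<open>
  Since \<open>1, \<i>\<close> is a real basis of \<open>\<complex>\<close>, each element of \<open>\<complex> \<otimes> A\<close> is uniquely of the form
  \<open>1 \<otimes> a + \<i> \<otimes> b\<close>, which is written \<open>CT a b\<close>. The lemmas \<open>tensor_universal\<close> and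
  \<open>tensor_mult\<close> below confirm that this is the tensor product over the reals with its usual
  multiplication.
\<close>

datatype 'a ctensor = CT (re_part: 'a) (im_part: 'a)

instantiation ctensor :: (ab_group_add) ab_group_add
begin

definition "0 = CT 0 0"
definition "w + v = CT (re_part w + re_part v) (im_part w + im_part v)"
definition "w - v = CT (re_part w - re_part v) (im_part w - im_part v)"
definition "- w = CT (- re_part w) (- im_part w)"

instance
  by standard
    (simp_all add: zero_ctensor_def plus_ctensor_def minus_ctensor_def uminus_ctensor_def
      algebra_simps)

end

instantiation ctensor :: (real_vector) real_vector
begin

definition "r *\<^sub>R w = CT (r *\<^sub>R re_part w) (r *\<^sub>R im_part w)"

instance
  by standard (simp_all add: scaleR_ctensor_def plus_ctensor_def algebra_simps)

end

instantiation ctensor :: (ring_1) ring_1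
begin

definition "1 = CT 1 0"
definition "w * v =
  CT (re_part w * re_part v - im_part w * im_part v)
     (re_part w * im_part v + im_part w * re_part v)"

instance
  by standard
    (simp_all add: zero_ctensor_def one_ctensor_def plus_ctensor_def minus_ctensor_def
      uminus_ctensor_def times_ctensor_def algebra_simps)

end

lemmas ctensor_defs = zero_ctensor_def one_ctensor_def plus_ctensor_def minus_ctensor_def
  uminus_ctensor_def scaleR_ctensor_def times_ctensor_def

instance ctensor :: (real_algebra_1) real_algebra_1
  by standard (simp_all add: ctensor_defs algebra_simps)

definition tensor :: "complex \<Rightarrow> 'a::real_vector \<Rightarrow> 'a ctensor" where
  "tensor z a = CT (Re z *\<^sub>R a) (Im z *\<^sub>R a)"

definition scaleC :: "complex \<Rightarrow> 'a::real_vector ctensor \<Rightarrow> 'a ctensor" where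
  "scaleC z w =
    CT (Re z *\<^sub>R re_part w - Im z *\<^sub>R im_part w) (Re z *\<^sub>R im_part w + Im z *\<^sub>R re_part w)"

lemma CT_eq_tensor: "CT a b = tensor 1 a + tensor \<i> b"
  by (simp add: tensor_def plus_ctensor_def)

lemma scaleC_tensor: "scaleC z (tensor u a) = tensor (z * u) a"
  by (simp add: scaleC_def tensor_def algebra_simps)

lemma tensor_mult:
  "tensor z (a::'a::real_algebra_1) * tensor u b = tensor (z * u) (a * b)"
  by (simp add: tensor_def times_ctensor_def algebra_simps)

lemma one_eq_tensor: "1 = tensor 1 (1::'a::real_algebra_1)"
  by (simp add: tensor_def one_ctensor_def)

lemma vector_space_scaleC: "vector_space scaleC"
  by standard (simp_all add: scaleC_def plus_ctensor_def algebra_simps)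

lemma linear_ctensor_iff:
  "Vector_Spaces.linear scaleC (*) f \<longleftrightarrow>
    (\<forall>w v. f (w + v) = f w + f v) \<and> (\<forall>z w. f (scaleC z w) = (z::complex) * f w)"
  by (simp add: Vector_Spaces.linear_iff vector_space_scaleC
      vector_space_over_itself.vector_space_axioms)

lemma scaleC_mult:
  fixes w v :: "'a::real_algebra_1 ctensor"
  shows "scaleC z w * v = scaleC z (w * v)" "w * scaleC z v = scaleC z (w * v)"
  by (simp_all add: scaleC_def times_ctensor_def algebra_simps)

lemma tensor_universal:
  fixes f :: "complex \<Rightarrow> 'a::real_vector \<Rightarrow> 'b::real_vector"
  assumes "bilinear f"
  shows "bilinear (tensor :: complex \<Rightarrow> 'a \<Rightarrow> 'a ctensor)"
    and "\<exists>!g. linear g \<and> (\<forall>z a. g (tensor z a) = f z a)"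
proof -
  show "bilinear (tensor :: complex \<Rightarrow> 'a \<Rightarrow> 'a ctensor)"
    unfolding bilinear_def
    by (auto intro!: linearI simp: tensor_def ctensor_defs algebra_simps)
  have l: "linear (f z)" "linear (\<lambda>z. f z a)" for z a
    using assms by (auto simp: bilinear_def)
  define g where "g = (\<lambda>w. f 1 (re_part w) + f \<i> (im_part w))"
  have "linear g"
    by (rule linearI)
      (simp_all add: g_def ctensor_defs linear_add[OF l(1)] linear_scale[OF l(1)] algebra_simps)
  moreover have "g (tensor z a) = f z a" for z a
  proof -
    have "z = Re z *\<^sub>R 1 + Im z *\<^sub>R \<i>"
      by (simp add: complex_eq_iff)
    then have "f z a = f (Re z *\<^sub>R 1 + Im z *\<^sub>R \<i>) a"
      by (rule arg_cong)
    also have "\<dots> = Re z *\<^sub>R f 1 a + Im z *\<^sub>R f \<i> a"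
      by (simp only: linear_add[OF l(2)] linear_scale[OF l(2)])
    finally show ?thesis
      by (simp add: g_def tensor_def linear_scale[OF l(1)])
  qed
  moreover have "h = g" if "linear h" "\<forall>z a. h (tensor z a) = f z a" for h
  proof
    fix w
    have "h w = h (tensor 1 (re_part w)) + h (tensor \<i> (im_part w))"
      by (simp only: linear_add[OF that(1), symmetric] CT_eq_tensor[symmetric] ctensor.collapse)
    then show "h w = g w"
      by (simp add: g_def that(2))
  qed
  ultimately show "\<exists>!g. linear g \<and> (\<forall>z a. g (tensor z a) = f z a)"
    by blast
qed


section \<open>Irreducibility in the Zariski topology\<close>

text \<open>Polynomial functions on \<open>\<complex> \<otimes> A\<close>, without choosing coordinates.\<close>

inductive polynomial_fun :: "('a::real_vector ctensor \<Rightarrow> complex) \<Rightarrow> bool" where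
  const: "polynomial_fun (\<lambda>w. c)"
| functional: "Vector_Spaces.linear scaleC (*) f \<Longrightarrow> polynomial_fun f"
| add: "polynomial_fun p \<Longrightarrow> polynomial_fun q \<Longrightarrow> polynomial_fun (\<lambda>w. p w + q w)"
| mult: "polynomial_fun p \<Longrightarrow> polynomial_fun q \<Longrightarrow> polynomial_fun (\<lambda>w. p w * q w)"

definition subvariety :: "'a::real_vector ctensor set \<Rightarrow> bool" where
  "subvariety V \<longleftrightarrow> (\<exists>P. (\<forall>p\<in>P. polynomial_fun p) \<and> V = {w. \<forall>p\<in>P. p w = 0})"

definition irreducible_subvariety :: "'a::real_vector ctensor set \<Rightarrow> bool" where
  "irreducible_subvariety V \<longleftrightarrow>
     subvariety V \<and> V \<noteq> {} \<and>
     (\<forall>V1 V2. subvariety V1 \<and> subvariety V2 \<and> V = V1 \<union> V2 \<longrightarrow> V = V1 \<or> V = V2)"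


section \<open>The sets \<open>\<Z>\<close> and \<open>Z\<^sub>0\<close>\<close>

definition left_mult :: "'a::real_algebra_1 \<Rightarrow> 'a \<Rightarrow> 'a" where
  "left_mult a = (\<lambda>x. a * x)"

text \<open>
  \<open>S0\<close> is empty for some algebras, for instance for the reals. Since \<open>Z_cal\<close> always contains 0
  while \<open>Z0\<close> is empty whenever \<open>S0\<close> is, an identity \<open>Z_cal = Z0\<close> presupposes \<open>S0 \<noteq> {}\<close>.
\<close>

definition S0 :: "'a::{real_algebra_1, euclidean_space} set" where
  "S0 = {s. s\<^sup>2 = - 1 \<and> left_mult s \<circ> adjoint (left_mult s) = id}"

definition pi_map :: "'a::real_algebra_1 ctensor \<Rightarrow> 'a \<Rightarrow> 'a" where
  "pi_map w s = re_part w + s * im_part w"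

definition Q :: "'a::real_inner ctensor \<Rightarrow> 'a ctensor \<Rightarrow> complex" where
  "Q w v =
    Complex (re_part w \<bullet> re_part v - im_part w \<bullet> im_part v)
            (re_part w \<bullet> im_part v + im_part w \<bullet> re_part v)"

lemma Q_tensor: "Q (tensor z a) (tensor u b) = z * u * of_real (a \<bullet> b)"
  by (simp add: Q_def tensor_def complex_eq_iff algebra_simps)

lemma Q_linear:
  fixes w v :: "'a::real_inner ctensor"
  shows "Vector_Spaces.linear scaleC (*) (Q w)"
    and "Vector_Spaces.linear scaleC (*) (\<lambda>w. Q w v)"
  unfolding linear_ctensor_iff
  by (simp_all add: Q_def scaleC_def plus_ctensor_def complex_eq_iff inner_simps algebra_simps)

definition \<Phi> :: "'a::real_inner ctensor \<Rightarrow> complex" where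
  "\<Phi> w = Q w w"

definition Z_cal :: "'a::{real_algebra_1, euclidean_space} ctensor set" where
  "Z_cal = {w. \<forall>w'. \<Phi> (w * w') = 0}"

lemma subvariety_Z_cal:
  "subvariety (Z_cal :: 'a::{real_algebra_1,euclidean_space} ctensor set)"
proof -
  let ?c = "\<lambda>(b::'a) w. Q w (CT b 0)"
  have Phi: "\<Phi> w = (\<Sum>b\<in>Basis. ?c b w * ?c b w)" for w :: "'a ctensor"
  proof -
    have "\<Phi> w = (\<Sum>b\<in>Basis. Complex
        ((re_part w \<bullet> b) * (re_part w \<bullet> b) - (im_part w \<bullet> b) * (im_part w \<bullet> b))
        ((re_part w \<bullet> b) * (im_part w \<bullet> b) + (im_part w \<bullet> b) * (re_part w \<bullet> b)))"
      unfolding \<Phi>_def Q_def complex_eq_iff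
      by (simp only: complex.sel Re_sum Im_sum sum.distrib sum_subtractf euclidean_inner[symmetric])
    also have "\<dots> = (\<Sum>b\<in>Basis. ?c b w * ?c b w)"
      by (rule sum.cong) (simp_all add: Q_def complex_eq_iff)
    finally show ?thesis .
  qed
  have poly: "polynomial_fun (\<lambda>w. ?c b (w * v))" for b and v :: "'a ctensor"
    using Q_linear(2)[of "CT b 0"]
    by (intro polynomial_fun.functional)
      (simp add: linear_ctensor_iff distrib_right scaleC_mult)
  have S: "polynomial_fun (\<lambda>w. \<Sum>b\<in>B. ?c b (w * v) * ?c b (w * v))"
    if "finite B" for B and v :: "'a ctensor"
    using that
  proof (induction B)
    case empty
    show ?case by (simp add: polynomial_fun.const)
  next
    case (insert b B)
    show ?case
      unfolding sum.insert[OF insert.hyps]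
      by (rule polynomial_fun.add[OF polynomial_fun.mult[OF poly poly] insert.IH])
  qed
  have "polynomial_fun (\<lambda>w. \<Phi> (w * v))" for v :: "'a ctensor"
    unfolding Phi by (rule S[OF finite_Basis])
  then show ?thesis
    unfolding subvariety_def Z_cal_def
    by (intro exI[of _ "range (\<lambda>v w. \<Phi> (w * v))"]) auto
qed

definition Z0 :: "'a::{real_algebra_1, euclidean_space} ctensor set" where
  "Z0 = {w. \<exists>s\<in>S0. pi_map w s = 0}"

end

theory Submission
  imports Defs "Jordan_Normal_Form.Determinant"
begin

text \<open>
  Let \<open>B\<close> be the set of \<open>b \<in> A\<close> for which the adjoint of \<open>L\<^sub>b\<close> is again a left multiplication,
  and let \<open>H\<close> be the commutant of \<open>L\<^sub>B\<close> in \<open>End A\<close>. It is closed under adjoints and contains all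
  right multiplications. The idea is to show that \<open>\<Z> = Y \<subseteq> Z\<^sub>0\<close> for
  \<open>Y = {w. Q(w, Tw) = 0 for all T \<in> H}\<close>, which is visibly Zariski closed.

  If \<open>w \<in> Y\<close>, then \<open>W = \<complex>H w\<close> is \<open>Q\<close>-isotropic. For \<open>s \<in> S\<^sub>0\<close> the space
  \<open>V = {v. \<pi>(v, s) = 0}\<close> equals its own \<open>Q\<close>-orthogonal, so \<open>U = W + (W\<^sup>\<bottom> \<inter> V)\<close> is a complex
  subspace that equals its own \<open>Q\<close>-orthogonal and is stable under right multiplications. Such a \<open>U\<close> is the graph of an
  orthogonal complex structure on \<open>A\<close> commuting with right multiplications, that is, of \<open>L\<^sub>t\<close>
  with \<open>t \<in> S\<^sub>0\<close>; hence \<open>w \<in> Z\<^sub>0\<close>.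

  Put \<open>w\<^sub>0 = \<i> - s\<close> and \<open>v\<^sub>0 = - \<i> - s\<close>, both in \<open>\<Z>\<close>. If \<open>w \<in> \<Z>\<close> and \<open>w + v\<^sub>0\<close> is
  invertible, then \<open>e = w (w + v\<^sub>0)\<^sup>-\<^sup>1\<close> and \<open>1 - e\<close> both lie in \<open>\<Z>\<close>, which forces the
  \<open>Q\<close>-transpose of \<open>L\<^sub>e\<close> to be \<open>L\<^bsub>1-e\<^esub>\<close>. So \<open>e \<in> \<complex> \<otimes> B\<close> and \<open>w \<in> Y\<close>. Therefore \<open>\<Z>\<close> is the union
  of \<open>Y\<close> and the closed subset where left multiplication by \<open>w + v\<^sub>0\<close> has determinant 0. The
  latter misses \<open>w\<^sub>0\<close>, as \<open>w\<^sub>0 + v\<^sub>0 = - 2 s\<close>; so irreducibility gives \<open>\<Z> = Y\<close>.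
\<close>

hide_const (open) Matrix.orthogonal
hide_fact (open) Matrix.orthogonal_def
no_notation scalar_prod (infix "\<bullet>" 70)

section \<open>Extending isotropic subspaces to self-orthogonal ones\<close>

lemma subspace_orthogonal_decomp:
  fixes S :: "'e::euclidean_space set"
  assumes "subspace S"
  obtains p q where "p \<in> S" "\<forall>y\<in>S. q \<bullet> y = 0" "x = p + q"
proof -
  obtain p q where "p \<in> span S" "\<And>y. y \<in> span S \<Longrightarrow> orthogonal q y" "x = p + q"
    using orthogonal_subspace_decomp_exists[of S x] by blast
  moreover have "span S = S"
    using assms by (rule span_eq_iff[THEN iffD2])
  ultimately show ?thesis
    using that[of p q] by (simp add: orthogonal_def)
qed

text \<open>The form in question is \<open>c x \<bullet> y\<close>. Isotropy of W and V puts U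
  inside its own orthogonal. For the converse, x is split along W + V and the Euclidean-orthogonal
  remainder is shown to vanish.\<close>

lemma self_orthogonal_extension:
  fixes c :: "'e::euclidean_space \<Rightarrow> 'e"
  assumes c: "\<And>x. c (c x) = x" "\<And>x y. c x \<bullet> y = x \<bullet> c y"
    and W: "subspace W" "\<And>x y. x \<in> W \<Longrightarrow> y \<in> W \<Longrightarrow> c x \<bullet> y = 0"
    and V: "subspace V" "\<And>x. x \<in> V \<longleftrightarrow> (\<forall>y\<in>V. c x \<bullet> y = 0)"
    and U: "U = {w + v | w v. w \<in> W \<and> v \<in> V \<and> (\<forall>y\<in>W. c v \<bullet> y = 0)}"
  shows "x \<in> U \<longleftrightarrow> (\<forall>y\<in>U. c x \<bullet> y = 0)"
proof
  have sym: "c x \<bullet> y = c y \<bullet> x" for x y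
    by (metis c(2) inner_commute)
  have V0: "c x \<bullet> y = 0" if "x \<in> V" "y \<in> V" for x y
    using that V(2) by blast
  assume "x \<in> U"
  then obtain w v where x: "x = w + v" "w \<in> W" "v \<in> V" "\<forall>y\<in>W. c v \<bullet> y = 0"
    using U by blast
  show "\<forall>y\<in>U. c x \<bullet> y = 0"
  proof
    fix y assume "y \<in> U"
    then obtain w' v' where y: "y = w' + v'" "w' \<in> W" "v' \<in> V" "\<forall>y\<in>W. c v' \<bullet> y = 0"
      using U by blast
    have add: "c (p + q) \<bullet> r = c p \<bullet> r + c q \<bullet> r" for p q r
      by (simp add: c(2) inner_simps)
    have "c x \<bullet> y = c w \<bullet> w' + c w \<bullet> v' + (c v \<bullet> w' + c v \<bullet> v')"
      unfolding x(1) y(1) add inner_add_right by (simp add: add_ac)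
    also have "\<dots> = 0"
      using x(2,4) y(2,4) W(2) V0[OF x(3) y(3)] sym[of w v'] by simp
    finally show "c x \<bullet> y = 0" .
  qed
next
  assume x: "\<forall>y\<in>U. c x \<bullet> y = 0"
  define S where "S = {a + b | a b. a \<in> W \<and> b \<in> V}"
  have "subspace S"
    unfolding S_def by (rule subspace_sums[OF W(1) V(1)])
  then obtain p q where pq: "p \<in> S" "\<forall>y\<in>S. q \<bullet> y = 0" "x = p + q"
    by (rule subspace_orthogonal_decomp[where x = x])
  have q: "q \<bullet> y = 0" if "y \<in> W \<or> y \<in> V" for y
  proof -
    have "y = y + 0" "y = 0 + y" by simp_all
    then have "y \<in> S"
      using that subspace_0[OF W(1)] subspace_0[OF V(1)] unfolding S_def by blast
    then show ?thesis
      using pq(2) by blast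
  qed
  \<comment> \<open>As \<open>q\<close> is Euclidean-orthogonal to W + V, \<open>c q\<close> is
    orthogonal to both summands for the form, hence lies in U. Testing x against it yields
    \<open>x \<bullet> q = 0\<close>.\<close>
  have "c q \<in> V"
    using V(2)[of "c q"] q by (simp add: c(1))
  moreover have "\<forall>y\<in>W. c (c q) \<bullet> y = 0"
    using q by (simp add: c(1))
  ultimately have "c q \<in> U"
    using subspace_0[OF W(1)] unfolding U by force
  then have "x \<bullet> q = 0"
    using x c by metis
  moreover have "q \<bullet> p = 0"
    using pq(1,2) by blast
  ultimately have "q = 0"
    using pq(3) by (simp add: inner_simps inner_commute)
  then obtain w v where wv: "x = w + v" "w \<in> W" "v \<in> V"
    using pq(1,3) by (auto simp: S_def)
  have "c v \<bullet> y = 0" if "y \<in> W" for y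
  proof -
    have "y \<in> U"
      using that subspace_0[OF V(1)] unfolding U
      by (force simp: c(2) intro: exI[of _ 0])
    then have "x \<bullet> c y = 0"
      using x c(2) by metis
    moreover have "w \<bullet> c y = 0"
      using W(2)[OF wv(2) that] c(2) by metis
    ultimately show ?thesis
      using wv(1) by (simp add: c(2) inner_simps)
  qed
  then show "x \<in> U"
    using wv unfolding U by blast
qed

section \<open>Adjointable left multiplications, their commutant, and skewness of
  \<open>S0\<close>\<close>

definition adjointable :: "'a::{real_algebra_1, euclidean_space} set" where
  "adjointable = {b. \<exists>b'. \<forall>x y. (b * x) \<bullet> y = x \<bullet> (b' * y)}"

definition commutant :: "('a::{real_algebra_1, euclidean_space} \<Rightarrow> 'a) set" where
  "commutant = {T. linear T \<and> (\<forall>b\<in>adjointable. \<forall>x. T (b * x) = b * T x)}"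

lemma linear_left_mult: "linear (left_mult (a::'a::{real_algebra_1, euclidean_space}))"
  by (auto intro!: linearI simp: left_mult_def algebra_simps)

text \<open>Once \<open>s * s = - 1\<close>, the inverse of L_s is - L_s, so both descriptions say
  that L_s is skew.\<close>

lemma S0_iff:
  fixes s :: "'a::{real_algebra_1, euclidean_space}"
  shows "s \<in> S0 \<longleftrightarrow> s * s = - 1 \<and> (\<forall>x y. (s * x) \<bullet> (s * y) = x \<bullet> y)"
proof -
  have adj: "x \<bullet> adjoint (left_mult s) y = (s * x) \<bullet> y" for x y
    using adjoint_works[OF linear_left_mult] by (simp add: left_mult_def)
  show ?thesis
  proof (intro iffI conjI allI)
    assume s: "s \<in> S0"
    then show sq: "s * s = - 1"
      by (simp add: S0_def power2_eq_square)
    have L: "s * adjoint (left_mult s) y = y" for y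
      using s by (auto simp: S0_def fun_eq_iff left_mult_def)
    have "adjoint (left_mult s) y = - (s * y)" for y
    proof -
      have "s * (s * adjoint (left_mult s) y) = s * y"
        by (simp add: L)
      then show ?thesis
        by (metis mult.assoc sq mult_minus1 minus_equation_iff)
    qed
    then have "(s * x) \<bullet> (s * y) = x \<bullet> (- (s * (s * y)))" for x y
      using adj by metis
    then show "(s * x) \<bullet> (s * y) = x \<bullet> y" for x y
      by (metis mult.assoc sq mult_minus1 minus_minus)
  next
    assume s: "s * s = - 1 \<and> (\<forall>x y. (s * x) \<bullet> (s * y) = x \<bullet> y)"
    have ss: "s * (s * x) = - x" for x
      using s by (metis mult.assoc mult_minus1)
    have "adjoint (left_mult s) y = - (s * y)" for y
    proof (rule vector_eq_rdot[THEN iffD1], rule allI)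
      fix x
      have "x \<bullet> adjoint (left_mult s) y = (s * (s * x)) \<bullet> (s * y)"
        using s by (simp add: adj)
      then show "adjoint (left_mult s) y \<bullet> x = - (s * y) \<bullet> x"
        by (simp add: ss inner_commute)
    qed
    then show "s \<in> S0"
      using s ss by (auto simp: S0_def power2_eq_square fun_eq_iff left_mult_def)
  qed
qed

lemma S0_sq:
  assumes "s \<in> S0" shows "s * (s * x) = - x"
  using assms by (metis S0_iff mult.assoc mult_minus1)

lemma S0_skew:
  assumes "s \<in> S0" shows "(s * x) \<bullet> y = - (x \<bullet> (s * y))"
  using assms S0_sq[OF assms, of y] by (metis S0_iff inner_minus_right minus_minus)

lemma commutant_comp: "T \<in> commutant \<Longrightarrow> S \<in> commutant \<Longrightarrow> T \<circ> S \<in> commutant"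
  by (simp add: commutant_def linear_compose)

lemma commutant_add: "T \<in> commutant \<Longrightarrow> S \<in> commutant \<Longrightarrow> (\<lambda>x. T x + S x) \<in> commutant"
  by (simp add: commutant_def linear_compose_add distrib_left)

lemma commutant_scaleR: "T \<in> commutant \<Longrightarrow> (\<lambda>x. r *\<^sub>R T x) \<in> commutant"
  by (simp add: commutant_def linear_compose_scale_right)

lemma commutant_minus: "T \<in> commutant \<Longrightarrow> (\<lambda>x. - T x) \<in> commutant"
  using commutant_scaleR[of T "-1"] by simp

lemma commutant_zero: "(\<lambda>x. 0) \<in> commutant"
  by (simp add: commutant_def linear_zero)

lemma commutant_id: "(\<lambda>x. x) \<in> commutant"
  by (simp add: commutant_def linear_ident)

lemma commutant_right_mult: "(\<lambda>x. x * a) \<in> commutant"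
  by (auto simp: commutant_def algebra_simps intro!: linearI)

text \<open>The witness \<open>b'\<close> is itself adjointable, with witness \<open>b\<close>;
  taking adjoints in the relation between T and L_b' gives the one for L_b.\<close>

lemma commutant_adjoint:
  fixes T :: "'a::{real_algebra_1, euclidean_space} \<Rightarrow> 'a"
  assumes T: "T \<in> commutant" shows "adjoint T \<in> commutant"
proof -
  have lin: "linear T" using T by (simp add: commutant_def)
  have "adjoint T (b * x) = b * adjoint T x" if b: "b \<in> adjointable" for b x
  proof -
    obtain b' where b': "\<And>x y. (b * x) \<bullet> y = x \<bullet> (b' * y)"
      using b by (auto simp: adjointable_def)
    have "(b' * x) \<bullet> y = x \<bullet> (b * y)" for x y
      using b'[of y x] by (simp add: inner_commute)
    then have "b' \<in> adjointable"
      by (auto simp: adjointable_def)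
    then have comm: "T (b' * y) = b' * T y" for y
      using T by (simp add: commutant_def)
    have "adjoint T (b * x) \<bullet> y = (b * adjoint T x) \<bullet> y" for y
    proof -
      have "adjoint T (b * x) \<bullet> y = x \<bullet> (b' * T y)"
        by (simp only: adjoint_clauses(2)[OF lin] b')
      also have "\<dots> = adjoint T x \<bullet> (b' * y)"
        by (simp only: adjoint_clauses(2)[OF lin] comm)
      finally show ?thesis
        by (simp only: b')
    qed
    then show ?thesis
      using vector_eq_rdot by blast
  qed
  then show ?thesis
    using adjoint_linear[OF lin] by (simp add: commutant_def)
qed

section \<open>The set Y of the overview and its inclusion in \<open>Z0\<close>\<close>

definition commutant_isotropic :: "'a::{real_algebra_1, euclidean_space} ctensor set" where
  "commutant_isotropic = {w. \<forall>T\<in>commutant. Q w (map_ctensor T w) = 0}"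

text \<open>Since \<open>adjoint T \<circ> S\<close> is again in the commutant, Q(Tw, Sw) = 0 for w
  = a + ib, with \<open>map_ctensor\<close> as complex-linear extension. The conclusions are its
  real and imaginary parts.\<close>

lemma commutant_isotropicD:
  fixes a b :: "'a::{real_algebra_1, euclidean_space}"
  assumes "CT a b \<in> commutant_isotropic" and T: "T \<in> commutant" "S \<in> commutant"
  shows "T a \<bullet> S a = T b \<bullet> S b" "T a \<bullet> S b + T b \<bullet> S a = 0"
proof -
  have lin: "linear T" using T by (simp add: commutant_def)
  have "Q (CT a b) (map_ctensor (adjoint T \<circ> S) (CT a b)) = 0"
    using assms(1) commutant_comp[OF commutant_adjoint[OF T(1)] T(2)]
    unfolding commutant_isotropic_def by blast
  then show "T a \<bullet> S a = T b \<bullet> S b" "T a \<bullet> S b + T b \<bullet> S a = 0"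
    by (simp_all add: Q_def adjoint_works[OF lin] complex_eq_iff)
qed

text \<open>A pair (a, b) stands for a + ib. Definiteness makes U the graph of a map g; right
  multiplications force g = L_t with t = g(1), stability under i gives t * t = -1, and
  self-orthogonality makes L_t an isometry.\<close>

lemma Z0I_self_orthogonal:
  fixes U :: "('a::{real_algebra_1, euclidean_space} \<times> 'a) set"
  assumes U: "subspace U"
    and self: "\<And>a b. (a, b) \<in> U \<longleftrightarrow> (\<forall>(c, d)\<in>U. a \<bullet> c = b \<bullet> d)"
    and im: "\<And>a b. (a, b) \<in> U \<Longrightarrow> (- b, a) \<in> U"
    and mult: "\<And>a b x. (a, b) \<in> U \<Longrightarrow> (a * x, b * x) \<in> U"
    and ab: "(a, b) \<in> U"
  shows "CT a b \<in> Z0"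
proof -
  have uniq: "u = v" if "(x, u) \<in> U" "(x, v) \<in> U" for x u v
  proof -
    have "(0, u - v) \<in> U"
      using subspace_diff[OF U that] by simp
    then have "(u - v) \<bullet> (u - v) = 0"
      using bspec[OF iffD1[OF self]] by fastforce
    then show ?thesis by simp
  qed
  have ex: "\<exists>u. (x, u) \<in> U" for x
  proof -
    obtain p q where pq: "p \<in> U" "\<forall>y\<in>U. q \<bullet> y = 0" "(x, 0) = p + q"
      using U by (rule subspace_orthogonal_decomp[where x = "(x, 0)"])
    \<comment> \<open>Flipping the second sign turns Euclidean orthogonality to U into orthogonality
      for the form, hence membership. Adding the result to \<open>p\<close> restores the first
      coordinate x.\<close>
    have "(fst q, - snd q) \<in> U"
      using pq(2) by (subst self) (auto simp: inner_prod_def)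
    then have "p + (fst q, - snd q) \<in> U"
      by (rule subspace_add[OF U pq(1)])
    moreover have "p + (fst q, - snd q) = (x, snd p - snd q)"
      using pq(3) by (auto simp: prod_eq_iff)
    ultimately show ?thesis by auto
  qed
  then obtain g where g: "(x, g x) \<in> U" for x
    by metis
  define t where "t = g 1"
  have gt: "g x = t * x" for x
    using uniq[OF g[of x]] mult[OF g[of 1], of x] by (simp add: t_def)
  have tt: "t * t = - 1"
  proof -
    have "(- t, 1) \<in> U"
      using im[OF g[of 1]] by (simp add: t_def)
    then have "t * (- t) = 1"
      using uniq g[of "- t"] gt by metis
    then show ?thesis
      by (metis minus_minus mult_minus_right)
  qed
  have "(t * x) \<bullet> (t * y) = x \<bullet> y" for x y
    using bspec[OF iffD1[OF self g] g, of x y] by (simp add: gt)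
  then have t: "t \<in> S0"
    using tt by (simp add: S0_iff)
  have "b = t * a"
    using uniq[OF ab g] gt by simp
  then have "pi_map (CT a b) t = 0"
    by (simp add: pi_map_def S0_sq[OF t])
  then show ?thesis
    using t by (auto simp: Z0_def)
qed

text \<open>Any \<open>s\<close> serves, as it only supplies the self-orthogonal V; the element of
  \<open>S0\<close> annihilating w is read off from U.\<close>

lemma commutant_isotropic_subset_Z0:
  fixes s :: "'a::{real_algebra_1, euclidean_space}"
  assumes s: "s \<in> S0"
  shows "(commutant_isotropic :: 'a ctensor set) \<subseteq> Z0"
proof
  fix w :: "'a ctensor"
  assume w: "w \<in> commutant_isotropic"
  obtain a b where wab: "w = CT a b" by (cases w)
  note iso = commutant_isotropicD[OF w[unfolded wab]]
  \<comment> \<open>These are the real and imaginary parts of (T + iS)(a + ib), so W is the complex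
    span of the commutant orbit of w.\<close>
  define W where "W = {(T a - S b, T b + S a) | T S. T \<in> commutant \<and> S \<in> commutant}"
  define V where "V = {(x, y). x + s * y = 0}"
  \<comment> \<open>Complex conjugation: \<open>c x \<bullet> y\<close> is the real part of Q. The
    spaces used are stable under i, so the real part determines orthogonality.\<close>
  define c where "c = (\<lambda>(x, y). (x :: 'a, - y :: 'a))"
  define U where "U = {w + v | w v. w \<in> W \<and> v \<in> V \<and> (\<forall>y\<in>W. c v \<bullet> y = 0)}"
  have cc: "c (c x) = x" "c x \<bullet> y = x \<bullet> c y" for x y
    by (auto simp: c_def inner_prod_def split: prod.splits)
  have WI: "(T a - S b, T b + S a) \<in> W" if "T \<in> commutant" "S \<in> commutant" for T S
    using that by (auto simp: W_def)
  have W: "subspace W"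
    unfolding subspace_def
  proof (intro conjI ballI allI)
    show "0 \<in> W"
      using WI[OF commutant_zero commutant_zero] by (simp add: zero_prod_def)
    show "x + y \<in> W" if xy: "x \<in> W" "y \<in> W" for x y
    proof -
      obtain T S T' S' where "T \<in> commutant" "S \<in> commutant" "x = (T a - S b, T b + S a)"
        "T' \<in> commutant" "S' \<in> commutant" "y = (T' a - S' b, T' b + S' a)"
        using xy by (auto simp: W_def)
      then show ?thesis
        using WI[OF commutant_add[of T T'] commutant_add[of S S']]
        by (simp add: algebra_simps)
    qed
    show "r *\<^sub>R x \<in> W" if x: "x \<in> W" for r x
    proof -
      obtain T S where "T \<in> commutant" "S \<in> commutant" "x = (T a - S b, T b + S a)"
        using x by (auto simp: W_def)
      then show ?thesis
        using WI[OF commutant_scaleR[of T r] commutant_scaleR[of S r]]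
        by (simp add: algebra_simps)
    qed
  qed
  have Wiso: "c x \<bullet> y = 0" if xy: "x \<in> W" "y \<in> W" for x y
  proof -
    obtain T S T' S' where *: "T \<in> commutant" "S \<in> commutant" "x = (T a - S b, T b + S a)"
      "T' \<in> commutant" "S' \<in> commutant" "y = (T' a - S' b, T' b + S' a)"
      using xy by (auto simp: W_def)
    show ?thesis
      using iso(1)[OF *(1,4)] iso(1)[OF *(2,5)] iso(2)[OF *(1,5)] iso(2)[OF *(2,4)]
      by (simp add: c_def * inner_prod_def inner_simps)
  qed
  have Wim: "(- y, x) \<in> W" if xy: "(x, y) \<in> W" for x y
  proof -
    obtain T S where "T \<in> commutant" "S \<in> commutant" "x = T a - S b" "y = T b + S a"
      using xy by (auto simp: W_def)
    then show ?thesis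
      using WI[OF commutant_minus[of S], of T] minus_diff_commute[of "S a" "T b"] by simp
  qed
  have Wmult: "(x * z, y * z) \<in> W" if xy: "(x, y) \<in> W" for x y z
  proof -
    obtain T S where "T \<in> commutant" "S \<in> commutant" "x = T a - S b" "y = T b + S a"
      using xy by (auto simp: W_def)
    then show ?thesis
      using WI[OF commutant_comp[OF commutant_right_mult[of z], of T]
          commutant_comp[OF commutant_right_mult[of z], of S]]
      by (simp add: distrib_right left_diff_distrib)
  qed
  have Wadj: "(R x, R y) \<in> W" if xy: "(x, y) \<in> W" and R: "R \<in> commutant" for x y R
  proof -
    have lin: "linear R" using R by (simp add: commutant_def)
    obtain T S where "T \<in> commutant" "S \<in> commutant" "x = T a - S b" "y = T b + S a"
      using xy by (auto simp: W_def)
    then show ?thesis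
      using WI[OF commutant_comp[OF R, of T] commutant_comp[OF R, of S]]
      by (simp add: linear_diff[OF lin] linear_add[OF lin])
  qed
  have V: "subspace V"
  proof -
    have "linear (\<lambda>p :: 'a \<times> 'a. fst p + s * snd p)"
      by (rule linearI) (simp_all add: algebra_simps)
    moreover have "V = {p. fst p + s * snd p = 0}"
      by (auto simp: V_def)
    ultimately show ?thesis
      using linear_subspace_kernel by blast
  qed
  have Vself: "x \<in> V \<longleftrightarrow> (\<forall>y\<in>V. c x \<bullet> y = 0)" for x
  proof -
    obtain p q where x: "x = (p, q)" by (cases x)
    \<comment> \<open>With V parametrized this way, skewness of L_s turns orthogonality to V into
      \<open>s * p = q\<close>, which is the equation of V multiplied by s.\<close>
    have "V = range (\<lambda>d. (- (s * d), d))"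
      by (auto simp: V_def add_eq_0_iff2)
    then have "(\<forall>y\<in>V. c x \<bullet> y = 0) \<longleftrightarrow> (\<forall>d. p \<bullet> (- (s * d)) - q \<bullet> d = 0)"
      by (simp add: c_def x inner_prod_def)
    also have "\<dots> \<longleftrightarrow> (\<forall>d. (s * p) \<bullet> d = q \<bullet> d)"
      by (auto simp: S0_skew[OF s])
    also have "\<dots> \<longleftrightarrow> s * p = q"
      by (rule vector_eq_rdot)
    also have "\<dots> \<longleftrightarrow> x \<in> V"
    proof
      show "x \<in> V" if "s * p = q"
        using S0_sq[OF s, of p] that by (simp add: V_def x)
      show "s * p = q" if "x \<in> V"
      proof -
        have "p = - (s * q)"
          using that by (simp add: V_def x eq_neg_iff_add_eq_0)
        then show ?thesis
          using S0_sq[OF s, of q] by simp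
      qed
    qed
    finally show ?thesis by simp
  qed
  have Uself: "x \<in> U \<longleftrightarrow> (\<forall>y\<in>U. c x \<bullet> y = 0)" for x
    by (rule self_orthogonal_extension[OF cc W Wiso V Vself U_def])
  have UselfD: "c x \<bullet> y = 0" if "x \<in> U" "y \<in> U" for x y
    using that Uself by blast
  have UI: "u + v \<in> U" if "u \<in> W" "v \<in> V" "\<forall>y\<in>W. c v \<bullet> y = 0" for u v
    using that unfolding U_def by blast
  have "CT a b \<in> Z0"
  proof (rule Z0I_self_orthogonal)
    show "subspace U"
      unfolding subspace_def
    proof (intro conjI ballI allI)
      show "0 \<in> U"
        by (rule iffD2[OF Uself]) (simp add: cc(2))
      show "x + y \<in> U" if "x \<in> U" "y \<in> U" for x y
        using UselfD[OF that(1)] UselfD[OF that(2)]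
        by (intro iffD2[OF Uself] ballI) (simp add: cc(2) inner_add_left)
      show "r *\<^sub>R x \<in> U" if "x \<in> U" for r x
        using UselfD[OF that] by (intro iffD2[OF Uself] ballI) (simp add: cc(2))
    qed
    show "(x, y) \<in> U \<longleftrightarrow> (\<forall>(p, q)\<in>U. x \<bullet> p = y \<bullet> q)" for x y
      unfolding Uself[of "(x, y)"] by (auto simp: c_def inner_prod_def)
    show "(a, b) \<in> U"
      using UI[OF WI[OF commutant_id commutant_zero] subspace_0[OF V]]
      by (simp add: cc(2))
    show "(- y, x) \<in> U" if xy: "(x, y) \<in> U" for x y
    proof -
      obtain p q p' q' where *: "(p, q) \<in> W" "(p', q') \<in> V" "\<forall>y\<in>W. c (p', q') \<bullet> y = 0"
        "x = p + p'" "y = q + q'"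
        using xy by (auto simp: U_def)
      have "(- q', p') \<in> V"
        using *(2) S0_sq[OF s, of q'] by (auto simp: V_def add_eq_0_iff)
      moreover have "c (- q', p') \<bullet> y = 0" if "y \<in> W" for y
        using bspec[OF *(3) Wim, of "fst y" "snd y"] that
        by (simp add: c_def inner_prod_def)
      ultimately show ?thesis
        using UI[OF Wim[OF *(1)], of "(- q', p')"] * by simp
    qed
    show "(x * z, y * z) \<in> U" if xy: "(x, y) \<in> U" for x y z
    proof -
      obtain p q p' q' where *: "(p, q) \<in> W" "(p', q') \<in> V" "\<forall>y\<in>W. c (p', q') \<bullet> y = 0"
        "x = p + p'" "y = q + q'"
        using xy by (auto simp: U_def)
      have lin: "linear (\<lambda>x. x * z)"
        using commutant_right_mult[of z] by (simp add: commutant_def)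
      have "(p' * z, q' * z) \<in> V"
        using *(2) by (auto simp: V_def) (metis distrib_right mult.assoc mult_zero_left)
      \<comment> \<open>The orthogonal of W is stable under right multiplication because the adjoint
        of that map lies in the commutant and so preserves W. Here closure of the commutant under
        adjoints is essential.\<close>
      moreover have "c (p' * z, q' * z) \<bullet> y = 0" if "y \<in> W" for y
        using bspec[OF *(3) Wadj[OF _ commutant_adjoint[OF commutant_right_mult]],
            of "fst y" "snd y" z] that
        by (simp add: c_def inner_prod_def adjoint_works[OF lin])
      ultimately show ?thesis
        using UI[OF Wmult[OF *(1)], of "(p' * z, q' * z)" z] *
        by (simp add: algebra_simps)
    qed
  qed
  then show "w \<in> Z0" by (simp add: wab)
qed

section \<open>Elements of \<open>Z_cal\<close> and complementary pairs\<close>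

lemma Z0_subset_Z_cal: "(Z0 :: 'a::{real_algebra_1, euclidean_space} ctensor set) \<subseteq> Z_cal"
proof
  fix w :: "'a ctensor"
  assume "w \<in> Z0"
  then obtain s where s: "s \<in> S0" "re_part w + s * im_part w = 0"
    by (auto simp: Z0_def pi_map_def)
  have re: "re_part w = - (s * im_part w)"
    using s(2) by (simp add: eq_neg_iff_add_eq_0)
  have "\<Phi> (w * v) = 0" for v
  proof -
    define q where "q = im_part (w * v)"
    have "re_part (w * v) = - (s * q)"
      by (simp add: q_def times_ctensor_def re distrib_left right_diff_distrib mult.assoc S0_sq[OF s(1)])
    moreover have "(s * q) \<bullet> q = 0" "(s * q) \<bullet> (s * q) = q \<bullet> q"
      using S0_skew[OF s(1), of q q] s(1) by (simp_all add: inner_commute S0_iff)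
    ultimately show ?thesis
      unfolding \<Phi>_def Q_def q_def[symmetric]
      by (simp add: complex_eq_iff inner_commute[of q "s * q"])
  qed
  then show "w \<in> Z_cal" by (simp add: Z_cal_def)
qed

lemma Q_add: "Q (u + v) w = Q u w + Q v w" "Q w (u + v) = Q w u + Q w v"
  by (simp_all add: Q_def plus_ctensor_def inner_simps complex_eq_iff)

lemma Q_commute: "Q u v = Q v u"
  by (simp add: Q_def inner_commute)

text \<open>Polarization of \<Phi> on the right ideal generated by w.\<close>

lemma Z_cal_orthogonal:
  assumes "w \<in> Z_cal" shows "Q (w * x) (w * y) = 0"
proof -
  have "\<Phi> (w * (x + y)) = \<Phi> (w * x) + \<Phi> (w * y) + 2 * Q (w * x) (w * y)"
    using Q_commute[of "w * y" "w * x"] by (simp add: \<Phi>_def distrib_left Q_add)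
  then show ?thesis
    using assms by (simp add: Z_cal_def)
qed

lemma commutant_isotropicI_complement:
  fixes w v :: "'a::{real_algebra_1, euclidean_space} ctensor"
  assumes Z: "w \<in> Z_cal" "v \<in> Z_cal" and u: "(w + v) * u = 1" "u * (w + v) = 1"
  shows "w \<in> commutant_isotropic"
proof -
  define e where "e = w * u"
  have v: "v * u = 1 - e"
    using u(1) by (simp add: e_def distrib_right eq_diff_eq add.commute)
  \<comment> \<open>Both e and 1 - e generate isotropic right ideals, so Q(ex, y) = Q(ex, (1-e)y) =
    Q(x, (1-e)y).\<close>
  have adj: "Q (e * x) y = Q x ((1 - e) * y)" for x y
  proof -
    have "Q (e * x) (e * y) = 0" "Q ((1 - e) * x) ((1 - e) * y) = 0"
      unfolding v[symmetric] unfolding e_def mult.assoc using Z Z_cal_orthogonal by blast+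
    then have "Q (e * x) (e * y + (1 - e) * y) = Q (e * x + (1 - e) * x) ((1 - e) * y)"
      unfolding Q_add by simp
    then show ?thesis
      by (simp add: left_diff_distrib)
  qed
  obtain a b where e: "e = CT a b" by (cases e)
  have "(a * x) \<bullet> y = x \<bullet> ((1 - a) * y)" "(b * x) \<bullet> y = x \<bullet> ((- b) * y)" for x y
    using adj[of "CT x 0" "CT y 0"]
    by (simp_all add: e Q_def times_ctensor_def minus_ctensor_def one_ctensor_def)
  then have ab: "a \<in> adjointable" "b \<in> adjointable"
    unfolding adjointable_def by blast+
  have ez: "e * (w + v) = w"
    using u(2) by (simp add: e_def mult.assoc)
  have "Q w (map_ctensor T w) = 0" if T: "T \<in> commutant" for T
  proof -
    have T': "linear T" "\<And>x. T (a * x) = a * T x" "\<And>x. T (b * x) = b * T x"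
      using T ab by (auto simp: commutant_def)
    have "map_ctensor T (e * z) = e * map_ctensor T z" for z
      by (cases z) (simp add: e times_ctensor_def linear_add[OF T'(1)] linear_diff[OF T'(1)] T'(2,3))
    \<comment> \<open>T commutes with L_e and w = e(w + v), so Tw lies in the right ideal of w,
      which is isotropic.\<close>
    then have "map_ctensor T w = w * (u * map_ctensor T (w + v))"
      using ez by (metis e_def mult.assoc)
    then show ?thesis
      using Z_cal_orthogonal[OF Z(1), of 1] by simp
  qed
  then show ?thesis
    by (simp add: commutant_isotropic_def)
qed

section \<open>Coordinates in the Q-orthonormal basis \<open>CT b 0\<close>, polynomials and
  determinants\<close>

lemma linear_ctensor_expand:
  fixes f :: "'a::euclidean_space ctensor \<Rightarrow> complex"
  assumes "Vector_Spaces.linear scaleC (*) f"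
  shows "f x = (\<Sum>b\<in>Basis. Q x (CT b 0) * f (CT b 0))"
proof -
  have f: "f (u + v) = f u + f v" "f (scaleC z u) = z * f u" for u v z
    using assms by (auto simp: linear_ctensor_iff)
  have lin: "linear (\<lambda>c. f (CT c 0))"
  proof (rule linearI)
    show "f (CT (c + d) 0) = f (CT c 0) + f (CT d 0)" for c d
      using f(1)[of "CT c 0" "CT d 0"] by (simp add: plus_ctensor_def)
    show "f (CT (r *\<^sub>R c) 0) = r *\<^sub>R f (CT c 0)" for r c
      using f(2)[of "of_real r" "CT c 0"] by (simp add: scaleC_def scaleR_conv_of_real)
  qed
  have real: "f (CT c 0) = (\<Sum>b\<in>Basis. (c \<bullet> b) *\<^sub>R f (CT b 0))" for c
  proof -
    have "f (CT c 0) = f (CT (\<Sum>b\<in>Basis. (c \<bullet> b) *\<^sub>R b) 0)"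
      by (simp add: euclidean_representation)
    also have "\<dots> = (\<Sum>b\<in>Basis. (c \<bullet> b) *\<^sub>R f (CT b 0))"
      by (simp only: linear_sum[OF lin] linear_scale[OF lin])
    finally show ?thesis .
  qed
  have "x = CT (re_part x) 0 + scaleC \<i> (CT (im_part x) 0)"
    by (cases x) (simp add: scaleC_def plus_ctensor_def)
  then have "f x = f (CT (re_part x) 0) + \<i> * f (CT (im_part x) 0)"
    using f by metis
  also have "\<dots> = (\<Sum>b\<in>Basis. Q x (CT b 0) * f (CT b 0))"
  proof -
    have "Q x (CT b 0) = of_real (re_part x \<bullet> b) + \<i> * of_real (im_part x \<bullet> b)" for b
      by (simp add: Q_def complex_eq_iff)
    then show ?thesis
      unfolding real[of "re_part x"] real[of "im_part x"] sum_distrib_left sum.distrib[symmetric]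
      by (simp add: scaleR_conv_of_real algebra_simps)
  qed
  finally show ?thesis .
qed

lemma polynomial_fun_sum:
  "(\<And>i. i \<in> I \<Longrightarrow> polynomial_fun (p i)) \<Longrightarrow> polynomial_fun (\<lambda>w. \<Sum>i\<in>I. p i w)"
  by (induction I rule: infinite_finite_induct)
    (auto intro: polynomial_fun.const polynomial_fun.add)

lemma polynomial_fun_prod:
  "(\<And>i. i \<in> I \<Longrightarrow> polynomial_fun (p i)) \<Longrightarrow> polynomial_fun (\<lambda>w. \<Prod>i\<in>I. p i w)"
  by (induction I rule: infinite_finite_induct)
    (auto intro: polynomial_fun.const polynomial_fun.mult)

lemma subvariety_commutant_isotropic:
  "subvariety (commutant_isotropic :: 'a::{real_algebra_1, euclidean_space} ctensor set)"
proof -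
  have "polynomial_fun (\<lambda>w. Q w (map_ctensor T w))" if T: "T \<in> commutant"
    for T :: "'a \<Rightarrow> 'a"
  proof -
    have lin: "linear T" using T by (simp add: commutant_def)
    have "polynomial_fun (\<lambda>w. Q (map_ctensor T w) (CT b 0))" for b
      by (rule polynomial_fun.functional)
        (auto simp: linear_ctensor_iff Q_def scaleC_def plus_ctensor_def complex_eq_iff
          ctensor.map_sel linear_add[OF lin] linear_diff[OF lin] linear_scale[OF lin]
          inner_simps algebra_simps)
    moreover have "polynomial_fun (\<lambda>w. Q w (CT b 0))" for b :: 'a
      by (rule polynomial_fun.functional[OF Q_linear(2)])
    ultimately have "polynomial_fun
        (\<lambda>w. \<Sum>b\<in>Basis. Q (map_ctensor T w) (CT b 0) * Q w (CT b 0))"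
      by (intro polynomial_fun_sum polynomial_fun.mult)
    then show ?thesis
      by (simp only: linear_ctensor_expand[OF Q_linear(1), symmetric])
  qed
  then show ?thesis
    unfolding subvariety_def commutant_isotropic_def
    by (intro exI[of _ "(\<lambda>T w. Q w (map_ctensor T w)) ` commutant"]) auto
qed

text \<open>In finite dimension injective left multiplication is surjective, which gives a right
  inverse u; cancelling z in z(uz - 1) = 0 makes it two-sided.\<close>

lemma ctensor_inverse:
  fixes z :: "'a::{real_algebra_1, euclidean_space} ctensor"
  assumes inj: "\<And>x. z * x = 0 \<Longrightarrow> x = 0"
  obtains u where "z * u = 1" "u * z = 1"
proof -
  define g where "g = (\<lambda>(a, b). (re_part (z * CT a b), im_part (z * CT a b)))"
  have lin: "linear g"
    by (rule linearI) (auto simp: g_def times_ctensor_def algebra_simps)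
  have "p = 0" if "g p = 0" for p
    using inj[of "CT (fst p) (snd p)"] that
    by (auto simp: g_def split_beta zero_prod_def prod_eq_iff zero_ctensor_def ctensor.expand)
  then have "inj g"
    using linear_injective_0[OF lin] by blast
  then have "surj g"
    by (rule linear_injective_imp_surjective[OF lin]) simp
  then obtain a b where "g (a, b) = (1, 0)"
    by (metis surjD surj_pair)
  then have u: "z * CT a b = 1"
    by (auto simp: g_def one_ctensor_def ctensor.expand)
  have "z * (CT a b * z - 1) = 0"
    using u by (simp add: right_diff_distrib mult.assoc[symmetric])
  then have "CT a b * z = 1"
    using inj by fastforce
  then show ?thesis
    using u that by blast
qed

text \<open>d is the determinant of left multiplication by w. The translate by \<open>c\<close> is
  included because the locus studied later is that of \<open>w + v0\<close>.\<close>

lemma ctensor_det: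
  obtains d :: "'a::{real_algebra_1, euclidean_space} ctensor \<Rightarrow> complex"
  where "\<And>c. polynomial_fun (\<lambda>w. d (w + c))"
    and "\<And>w. d w = 0 \<longleftrightarrow> (\<exists>x. x \<noteq> 0 \<and> w * x = 0)"
proof -
  define n where "n = DIM('a)"
  obtain h :: "nat \<Rightarrow> 'a" where h: "bij_betw h {0..<n} Basis"
    using ex_bij_betw_nat_finite[OF finite_Basis] unfolding n_def by blast
  define \<beta> where "\<beta> j = CT (h j) 0" for j
  \<comment> \<open>M is the matrix of left multiplication by w in the basis \<beta>, and V below
    gives the coordinate vector; Q reads off coordinates by orthonormality.\<close>
  define M where "M w = mat n n (\<lambda>(i, j). Q (w * \<beta> j) (\<beta> i))" for w
  define V where "V x = vec n (\<lambda>j. Q x (\<beta> j))" for x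
  have M: "M w \<in> carrier_mat n n" for w
    by (simp add: M_def)
  have V: "V x \<in> carrier_vec n" for x
    by (simp add: V_def)
  have sum_h: "(\<Sum>b\<in>Basis. k b) = (\<Sum>j = 0..<n. k (h j))" for k :: "'a \<Rightarrow> complex"
    by (rule sum.reindex_bij_betw[OF h, symmetric])
  have lin: "Vector_Spaces.linear scaleC (*) (\<lambda>x. Q (w * x) v)" for w v :: "'a ctensor"
    using Q_linear(2)[of v] by (simp add: linear_ctensor_iff distrib_left scaleC_mult)
  have lin': "Vector_Spaces.linear scaleC (*) (\<lambda>w. Q (w * x) v)" for x v :: "'a ctensor"
    using Q_linear(2)[of v] by (simp add: linear_ctensor_iff distrib_right scaleC_mult)
  have MV: "M w *\<^sub>v V x = V (w * x)" for w x
  proof (rule eq_vecI)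
    fix i assume "i < dim_vec (V (w * x))"
    then have i: "i < n" by (simp add: V_def)
    have "(M w *\<^sub>v V x) $ i = (\<Sum>j = 0..<n. Q (w * \<beta> j) (\<beta> i) * Q x (\<beta> j))"
      using i by (simp add: M_def V_def scalar_prod_def)
    also have "\<dots> = Q (w * x) (\<beta> i)"
    proof -
      have "Q (w * x) (\<beta> i) = (\<Sum>b\<in>Basis. Q x (CT b 0) * Q (w * CT b 0) (\<beta> i))"
        by (rule linear_ctensor_expand[OF lin])
      then show ?thesis
        unfolding sum_h by (simp add: \<beta>_def mult.commute)
    qed
    finally show "(M w *\<^sub>v V x) $ i = V (w * x) $ i"
      using i by (simp add: V_def)
  qed (simp add: M_def V_def)
  have V0: "V x = 0\<^sub>v n \<longleftrightarrow> x = 0" for x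
  proof
    assume x: "V x = 0\<^sub>v n"
    have "Q x (\<beta> j) = 0" if "j < n" for j
      using arg_cong[OF x, of "\<lambda>v. v $ j"] that by (simp add: V_def)
    then have "Q x (CT b 0) = 0" if "b \<in> Basis" for b
    proof -
      obtain j where "j < n" "b = h j"
        using \<open>b \<in> Basis\<close> bij_betw_imp_surj_on[OF h] by fastforce
      then show ?thesis
        using \<open>\<And>j. j < n \<Longrightarrow> Q x (\<beta> j) = 0\<close> by (simp add: \<beta>_def)
    qed
    then have "re_part x \<bullet> b = 0 \<bullet> b" "im_part x \<bullet> b = 0 \<bullet> b" if "b \<in> Basis" for b
      using that by (auto simp: Q_def complex_eq_iff)
    then have "re_part x = 0" "im_part x = 0"
      by (auto intro: euclidean_eqI)
    then show "x = 0"
      by (simp add: zero_ctensor_def ctensor.expand)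
  qed (auto simp: V_def Q_def zero_ctensor_def complex_eq_iff)
  \<comment> \<open>Needed to turn a kernel vector of the matrix back into an element x with
    \<open>w * x = 0\<close>.\<close>
  have surj: "\<exists>x. V x = v" if v: "v \<in> carrier_vec n" for v
  proof -
    define k where "k = inv_into {0..<n} h"
    have k: "k (h j) = j" if "j < n" for j
      using that bij_betw_inv_into_left[OF h] by (simp add: k_def)
    define x where "x = CT (\<Sum>b\<in>Basis. Re (v $ k b) *\<^sub>R b) (\<Sum>b\<in>Basis. Im (v $ k b) *\<^sub>R b)"
    have hB: "h j \<in> Basis" if "j < n" for j
      using that bij_betwE[OF h] by simp
    have "Q x (\<beta> j) = v $ j" if "j < n" for j
      using hB[OF that] k[OF that] by (simp add: Q_def x_def \<beta>_def complex_eq_iff)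
    then have "V x = v"
      using v by (intro eq_vecI) (auto simp: V_def)
    then show ?thesis ..
  qed
  have "polynomial_fun (\<lambda>w. det (M (w + c)))" for c
  proof -
    have "polynomial_fun (\<lambda>w. M (w + c) $$ (i, j))" if ij: "i < n" "j < n" for i j
    proof -
      have "(\<lambda>w. M (w + c) $$ (i, j)) = (\<lambda>w. Q (w * \<beta> j) (\<beta> i) + Q (c * \<beta> j) (\<beta> i))"
        using ij by (simp add: M_def distrib_right Q_add)
      then show ?thesis
        using polynomial_fun.add[OF polynomial_fun.functional[OF lin'] polynomial_fun.const]
        by simp
    qed
    moreover have "p i < n" if "p permutes {0..<n}" "i < n" for p i
      using permutes_in_image[OF that(1), of i] that(2) by simp
    ultimately show ?thesis
      unfolding det_def'[OF M]
      by (intro polynomial_fun_sum polynomial_fun.mult polynomial_fun.const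
          polynomial_fun_prod) auto
  qed
  moreover have "det (M w) = 0 \<longleftrightarrow> (\<exists>x. x \<noteq> 0 \<and> w * x = 0)" for w
    unfolding det_0_iff_vec_prod_zero[OF M] using MV V0 surj V by metis
  ultimately show ?thesis
    by (rule that)
qed

section \<open>Splitting \<open>Z_cal\<close> into Y and a determinant locus\<close>

theorem theorem5p11:
  assumes "(1::'a::{real_algebra_1, euclidean_space}) \<bullet> 1 = 1"
    and "(S0 :: 'a set) \<noteq> {}"
    and "irreducible_subvariety (Z_cal :: 'a ctensor set)"
  shows "(Z_cal :: 'a ctensor set) = Z0"
proof -
  obtain s :: 'a where s: "s \<in> S0"
    using assms(2) by blast
  then have s': "- s \<in> S0"
    by (simp add: S0_iff)
  \<comment> \<open>These are i - s and - i - s, annihilated by \<open>pi_map\<close> at s and - s;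
    their sum - 2s is invertible.\<close>
  define w0 where "w0 = CT (- s) 1"
  define v0 where "v0 = CT (- s) (- 1)"
  have "w0 \<in> Z0" "v0 \<in> Z0"
    using s s' by (auto simp: Z0_def w0_def v0_def pi_map_def intro: bexI[of _ s] bexI[of _ "- s"])
  then have Z: "w0 \<in> Z_cal" "v0 \<in> Z_cal"
    using Z0_subset_Z_cal by blast+
  obtain d :: "'a ctensor \<Rightarrow> complex" where
    poly: "\<And>c. polynomial_fun (\<lambda>w. d (w + c))" and
    d: "\<And>w. d w = 0 \<longleftrightarrow> (\<exists>x. x \<noteq> 0 \<and> w * x = 0)"
    using ctensor_det by blast
  define D where "D = {w \<in> Z_cal. d (w + v0) = 0}"
  have "subvariety D"
  proof -
    obtain P where P: "\<forall>p\<in>P. polynomial_fun p" "(Z_cal :: 'a ctensor set) = {w. \<forall>p\<in>P. p w = 0}"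
      using subvariety_Z_cal unfolding subvariety_def by blast
    then show ?thesis
      unfolding subvariety_def D_def
      by (intro exI[of _ "insert (\<lambda>w. d (w + v0)) P"]) (auto simp: poly)
  qed
  moreover have "w \<in> commutant_isotropic" if w: "w \<in> Z_cal" "w \<notin> D" for w
  proof -
    have "x = 0" if "(w + v0) * x = 0" for x
      using w d that by (auto simp: D_def)
    then obtain u where "(w + v0) * u = 1" "u * (w + v0) = 1"
      by (rule ctensor_inverse)
    then show ?thesis
      by (rule commutant_isotropicI_complement[OF w(1) Z(2)])
  qed
  then have "(Z_cal :: 'a ctensor set) = commutant_isotropic \<union> D"
    using commutant_isotropic_subset_Z0[OF s] Z0_subset_Z_cal unfolding D_def by blast
  moreover have "w0 \<notin> D"
  proof -
    have "x = 0" if x: "(w0 + v0) * x = 0" for x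
    proof -
      have "w0 + v0 = scaleC (- 2) (CT s 0)"
        by (simp add: w0_def v0_def plus_ctensor_def scaleC_def scaleR_2)
      \<comment> \<open>Multiplying - 2s by s gives the scalar 2, so the sum is injective.\<close>
      then have "CT s 0 * (scaleC (- 2) (CT s 0) * x) = 0"
        using x by simp
      then have "scaleC 2 x = 0"
        by (cases x) (simp add: scaleC_def times_ctensor_def zero_ctensor_def S0_sq[OF s])
      then show ?thesis
        by (cases x) (simp add: scaleC_def zero_ctensor_def)
    qed
    then show ?thesis
      using d by (auto simp: D_def)
  qed
  \<comment> \<open>Irreducibility leaves Y or D as the whole of \<open>Z_cal\<close>, and
    \<open>w0\<close> excludes D.\<close>
  ultimately have "(Z_cal :: 'a ctensor set) = commutant_isotropic"
    using assms(3) Z(1) subvariety_commutant_isotropic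
    unfolding irreducible_subvariety_def by metis
  then show ?thesis
    using commutant_isotropic_subset_Z0[OF s] Z0_subset_Z_cal by blast
qed

end
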